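(* Let $d\ge1$, let $S=\{\mathbf{x}\in\mathbb{R}^d_+:\sum_{i=1}^d x_i\le1\}$, and let $\phi^*$ be the uniform probability distribution on $S$. Let $n\in\{1,2\}$ and $\hat{s}(n)=\binom{d+1+n}{n}$. Then the optimization problem over vectors $\mathbf{c}=(c_{\alpha})_{\alpha\in\mathbb{N}^{d+1}_n}$ $$\mathbf{P}:\quad \sup_{\mathbf{c}\ge0}\Big\{\sum_{\alpha\in\mathbb{N}^{d+1}_n}\log c_{\alpha}\ :\ \hat{s}(n)=\sum_{\alpha\in\mathbb{N}^{d+1}_n}c_{\alpha}\,\mathbf{g}(\mathbf{x})^{\alpha}\,,\ \forall \mathbf{x}\in\mathbb{R}^d\Big\}$$ has a unique optimal solution $\mathbf{c}^*\in\mathbb{R}^{\hat{s}(n)}$, it satisfies $\mathbf{c}^*>0$ and $$\frac{1}{c^*_{\alpha}}=\phi^*(\mathbf{g}^{\alpha})\,,\quad\forall\alpha\in\mathbb{N}^{d+1}_n,$$ and $$1=\frac{1}{\hat{s}(n)}\sum_{\alpha\in\mathbb{N}^{d+1}_n}\frac{\mathbf{g}(\mathbf{x})^{\alpha}}{\phi^*(\mathbf{g}^{\alpha})}\,,\quad\forall\mathbf{x}\in\mathbb{R}^d.$$ Therefore the $\hat{s}(n)$ polynomials $\frac{1}{\hat{s}(n)}\frac{\mathbf{g}^{\alpha}}{\phi^*(\mathbf{g}^{\alpha})}$, $\alpha\in\mathbb{N}^{d+1}_n$, provide $S$ with a partition of unity (which maximizes the entropy criterion in $\mathbf{P}$).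
   Context: $\mathbb{N}=\{0,1,2,\ldots\}$, and $\mathbb{N}^{d+1}_n=\{\alpha\in\mathbb{N}^{d+1}:\alpha_1+\cdots+\alpha_{d+1}\le n\}$, which has $\hat{s}(n)$ elements. The polynomials $g_1,\dots,g_{d+1}$ on $\mathbb{R}^d$ are $g_j(\mathbf{x})=x_j$ for $j=1,\ldots,d$ and $g_{d+1}(\mathbf{x})=1-\sum_{j=1}^dx_j$, so $S=\{\mathbf{x}: g_j(\mathbf{x})\ge0,\ j=1,\ldots,d+1\}$. For $\alpha\in\mathbb{N}^{d+1}$, $\mathbf{g}(\mathbf{x})^{\alpha}=g_1(\mathbf{x})^{\alpha_1}\cdots g_{d+1}(\mathbf{x})^{\alpha_{d+1}}$. The uniform probability distribution on $S$ is Lebesgue measure on $S$ scaled to a probability measure, and $\phi^*(q)=\int_S q\,d\phi^*$ for a polynomial $q$. Vector inequalities are entrywise, and $\log 0=-\infty$. A finite family of polynomials is a partition of unity of $S$ if each is nonnegative on $S$ and they sum to $1$. *)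

theory Defs
  imports "HOL-Analysis.Analysis" "HOL-Library.Multiset"
begin

text \<open>
  The space is \<open>real ^ 'd\<close>, so that \<open>d = CARD('d) \<ge> 1\<close>. The \<open>d + 1\<close> indices of the polynomials
  \<open>g\<^sub>1, \<dots>, g\<^sub>d\<^sub>+\<^sub>1\<close> are the elements of \<open>'d option\<close>, where \<open>None\<close> stands for the last index \<open>d + 1\<close>.
\<close>

definition simplex_set :: "(real ^ 'd) set"
  where "simplex_set = {x. (\<forall>i. 0 \<le> x $ i) \<and> (\<Sum>i\<in>UNIV. x $ i) \<le> 1}"

fun g_poly :: "'d option \<Rightarrow> real ^ 'd \<Rightarrow> real" where
  "g_poly (Some j) x = x $ j"
| "g_poly None x = 1 - (\<Sum>j\<in>UNIV. x $ j)"

definition gpow :: "('d::finite option \<Rightarrow> nat) \<Rightarrow> real ^ 'd \<Rightarrow> real"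
  where "gpow \<alpha> x = (\<Prod>j\<in>UNIV. g_poly j x ^ \<alpha> j)"

definition multi_indices :: "nat \<Rightarrow> ('d::finite option \<Rightarrow> nat) set"
  where "multi_indices n = {\<alpha>. (\<Sum>j\<in>UNIV. \<alpha> j) \<le> n}"

definition s_hat :: "nat \<Rightarrow> nat \<Rightarrow> nat"
  where "s_hat d n = (d + 1 + n) choose n"

definition unif_simplex :: "(real ^ 'd) measure"
  where "unif_simplex = uniform_measure lborel simplex_set"

definition phi_star :: "(real ^ 'd \<Rightarrow> real) \<Rightarrow> real"
  where "phi_star q = (LINT x:simplex_set|unif_simplex. q x)"

definition elog :: "real \<Rightarrow> ereal"
  where "elog c = (if c = 0 then -\<infinity> else ereal (ln c))"

definition entropy :: "nat \<Rightarrow> (('d::finite option \<Rightarrow> nat) \<Rightarrow> real) \<Rightarrow> ereal"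
  where "entropy n c = (\<Sum>\<alpha>\<in>multi_indices n. elog (c \<alpha>))"

text \<open>
  A vector indexed by \<open>multi_indices n\<close> is an extensional function on that set, so that two
  vectors are equal as functions iff all their entries agree.
\<close>

definition feasible :: "nat \<Rightarrow> (('d::finite option \<Rightarrow> nat) \<Rightarrow> real) \<Rightarrow> bool"
  where "feasible n c \<longleftrightarrow>
    c \<in> multi_indices n \<rightarrow>\<^sub>E {0..} \<and>
    (\<forall>x. real (s_hat CARD('d) n) = (\<Sum>\<alpha>\<in>multi_indices n. c \<alpha> * gpow \<alpha> x))"

definition optimal_solution :: "nat \<Rightarrow> (('d::finite option \<Rightarrow> nat) \<Rightarrow> real) \<Rightarrow> bool"
  where "optimal_solution n c \<longleftrightarrow> is_arg_max (entropy n) (feasible n) c"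

text \<open>The members of the family sum to 1 as polynomials, hence on the whole space.\<close>

definition polynomial_partition_of_unity ::
    "('a::real_normed_vector) set \<Rightarrow> 'i set \<Rightarrow> ('i \<Rightarrow> 'a \<Rightarrow> real) \<Rightarrow> bool"
  where "polynomial_partition_of_unity S I p \<longleftrightarrow>
    finite I \<and>
    (\<forall>i\<in>I. real_polynomial_function (p i)) \<and>
    (\<forall>i\<in>I. \<forall>x\<in>S. 0 \<le> p i x) \<and>
    (\<forall>x. (\<Sum>i\<in>I. p i x) = 1)"

lemma card_multi_indices_eq:
  "card {\<alpha> :: 'd::finite option \<Rightarrow> nat. (\<Sum>j\<in>UNIV. \<alpha> j) = k} = (CARD('d) + k) choose k"
proof -
  have size: "size M = (\<Sum>j\<in>UNIV. count M j)" for M :: "'d option multiset"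
    unfolding size_multiset_overloaded_eq
    by (intro sum.mono_neutral_cong_left) (auto simp: not_in_iff)
  have "bij_betw count (multisets_of_size (UNIV :: 'd option set) k) {\<alpha>. (\<Sum>j\<in>UNIV. \<alpha> j) = k}"
    by (rule bij_betwI[where g = Abs_multiset])
       (auto simp: multisets_of_size_def size count_inverse Abs_multiset_inverse)
  from bij_betw_same_card[OF this] show ?thesis
    by (simp add: card_multisets_of_size card_UNIV_option)
qed

lemma finite_multi_indices_eq:
  "finite {\<alpha> :: 'd::finite option \<Rightarrow> nat. (\<Sum>j\<in>UNIV. \<alpha> j) = k}"
  by (rule card_ge_0_finite) (simp add: card_multi_indices_eq)

lemma card_multi_indices:
  "card (multi_indices n :: ('d::finite option \<Rightarrow> nat) set) = s_hat CARD('d) n"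
proof -
  have "(multi_indices n :: ('d option \<Rightarrow> nat) set) = (\<Union>k\<le>n. {\<alpha>. (\<Sum>j\<in>UNIV. \<alpha> j) = k})"
    by (auto simp: multi_indices_def)
  then have "card (multi_indices n :: ('d option \<Rightarrow> nat) set) = (\<Sum>k\<le>n. (CARD('d) + k) choose k)"
    by (simp add: card_UN_disjoint card_multi_indices_eq finite_multi_indices_eq disjoint_iff)
  then show ?thesis by (simp add: sum_choose_lower s_hat_def)
qed

end

theory Submission
  imports Defs
begin

text \<open>
  The uniform distribution on the simplex is the flat Dirichlet distribution, so its moments are
  \<open>\<phi>\<^sup>*(g\<^sup>\<alpha>) = d! \<Prod>\<^sub>j \<alpha>\<^sub>j! / (d + |\<alpha>|)!\<close>. As the \<open>g\<^sub>j\<close> sum to 1, the multinomial theorem gives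
  \<open>\<Sum>\<^bsub>|\<alpha>| = k\<^esub> g\<^sup>\<alpha> / \<phi>\<^sup>*(g\<^sup>\<alpha>) = (d + k) choose k\<close>, and summing over \<open>k \<le> n\<close> yields the
  identity. Integrating the constraint shows that every feasible \<open>c\<close> satisfies
  \<open>\<Sum>\<^sub>\<alpha> c\<^sub>\<alpha> \<phi>\<^sup>*(g\<^sup>\<alpha>) = s(n)\<close>, the number of indices, so \<open>ln t \<le> t - 1\<close> at
  \<open>t = c\<^sub>\<alpha> \<phi>\<^sup>*(g\<^sup>\<alpha>)\<close> bounds the entropy of \<open>c\<close> by that of \<open>1 / \<phi>\<^sup>*(g\<^sup>\<alpha>)\<close>, with equality only
  there.
\<close>

section \<open>Dirichlet integrals over a simplex\<close>

text \<open>Beta integral scaled to \<open>{0..t}\<close>. Integration by parts trades a factor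
  \<open>y\<close> for a factor \<open>t - y\<close>, so the induction on \<open>b\<close> must
  leave \<open>m\<close> arbitrary.\<close>

lemma has_integral_power_mult_power:
  fixes t :: real
  assumes "t \<ge> 0"
  shows "((\<lambda>y. y ^ b * (t - y) ^ m) has_integral
           fact b * fact m / fact (b + m + 1) * t ^ (b + m + 1)) {0..t}"
proof -
  have deriv: "((\<lambda>y. - ((t - y) ^ Suc m / Suc m)) has_real_derivative (t - y) ^ m) (at y within S)"
    for m y S
    by (rule DERIV_cong,
        (rule DERIV_minus DERIV_cdivide DERIV_power_Suc DERIV_diff DERIV_const DERIV_ident)+)
       (simp add: field_simps)
  show ?thesis
  proof (induction b arbitrary: m)
    case 0
    have "((\<lambda>y. (t - y) ^ m) has_integral
            (- ((t - t) ^ Suc m / Suc m)) - (- ((t - 0) ^ Suc m / Suc m))) {0..t}"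
      using assms deriv
      by (intro fundamental_theorem_of_calculus)
         (simp_all flip: has_real_derivative_iff_has_vector_derivative)
    then show ?case by simp
  next
    case (Suc b)
    let ?I = "fact b * fact (Suc m) / fact (b + Suc m + 1) * t ^ (b + Suc m + 1)"
    \<comment> \<open>Product rule for \<open>y ^ Suc b\<close> times the antiderivative of
      \<open>(t - y) ^ m\<close>. This product vanishes at \<open>0\<close> and at \<open>t\<close>,
      so the two resulting integrals cancel.\<close>
    have deriv': "((\<lambda>y. y ^ Suc b * - ((t - y) ^ Suc m / Suc m)) has_real_derivative
        y ^ Suc b * (t - y) ^ m - Suc b / Suc m * (y ^ b * (t - y) ^ Suc m)) (at y within {0..t})" for y
      by (rule derivative_eq_intros deriv refl DERIV_power_Suc)+ (simp add: divide_simps)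
    have "((\<lambda>y. y ^ Suc b * (t - y) ^ m - Suc b / Suc m * (y ^ b * (t - y) ^ Suc m)) has_integral
            t ^ Suc b * - ((t - t) ^ Suc m / Suc m) - 0 ^ Suc b * - ((t - 0) ^ Suc m / Suc m))
           {0..t}"
      using assms deriv'
      by (intro fundamental_theorem_of_calculus)
         (simp_all flip: has_real_derivative_iff_has_vector_derivative)
    from has_integral_add[OF this has_integral_mult_right[OF Suc.IH[of "Suc m"], of "Suc b / Suc m"]]
    have "((\<lambda>y. y ^ Suc b * (t - y) ^ m) has_integral Suc b / Suc m * ?I) {0..t}"
      by simp
    also have "Suc b / Suc m * ?I = fact (Suc b) * fact m / fact (Suc b + m + 1) * t ^ (Suc b + m + 1)"
      by (simp del: of_nat_Suc add: fact_Suc[of b] fact_Suc[of m])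
    finally show ?case .
  qed
qed

text \<open>Integrate one coordinate at a time: fixing it at \<open>y\<close> leaves a simplex of
  size \<open>t - y\<close>, hence the general size \<open>t\<close>, and the outer integral is a
  Beta integral. The slack \<open>t - sum x A\<close> serves as the last barycentric coordinate,
  with exponent \<open>k\<close>. Nonnegative integrals allow Fubini without integrability
  conditions.\<close>

lemma nn_integral_simplex_monomial_PiM:
  fixes t :: real and a :: "'a \<Rightarrow> nat"
  assumes "finite A" "t \<ge> 0"
  shows "(\<integral>\<^sup>+ x. ennreal (indicator {x. (\<forall>i\<in>A. 0 \<le> x i) \<and> sum x A \<le> t} x *
             ((\<Prod>i\<in>A. x i ^ a i) * (t - sum x A) ^ k)) \<partial>Pi\<^sub>M A (\<lambda>_. lborel)) =
         ennreal ((\<Prod>i\<in>A. fact (a i)) * fact k / fact (card A + sum a A + k) *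
                  t ^ (card A + sum a A + k))"
  using assms
proof (induction arbitrary: t rule: finite_induct)
  case (empty t)
  then show ?case by (simp add: PiM_empty nn_integral_count_space_finite)
next
  case (insert b A t)
  let ?M = "\<lambda>A. Pi\<^sub>M A (\<lambda>_. lborel :: real measure)"
  define S :: "'a set \<Rightarrow> real \<Rightarrow> ('a \<Rightarrow> real) set"
    where "S = (\<lambda>A t. {x. (\<forall>i\<in>A. 0 \<le> x i) \<and> sum x A \<le> t})"
  define f :: "'a set \<Rightarrow> real \<Rightarrow> ('a \<Rightarrow> real) \<Rightarrow> real"
    where "f = (\<lambda>A t x. indicator (S A t) x * ((\<Prod>i\<in>A. x i ^ a i) * (t - sum x A) ^ k))"
  define C :: real where "C = (\<Prod>i\<in>A. fact (a i)) * fact k / fact (card A + sum a A + k)"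
  define m where "m = card A + sum a A + k"
  have C_nonneg: "C \<ge> 0" by (simp add: C_def prod_nonneg)
  have meas [measurable]: "f B s \<in> borel_measurable (?M B)" if [simp]: "finite B" for B s
  proof -
    have "Measurable.pred (?M B) (\<lambda>x. (\<forall>i\<in>B. 0 \<le> x i) \<and> sum x B \<le> s)" by measurable
    then have [measurable]: "(\<lambda>x. indicator (S B s) x :: real) \<in> borel_measurable (?M B)"
      unfolding S_def by (simp add: borel_measurable_indicator_iff pred_def Int_def conj_commute)
    show ?thesis unfolding f_def by measurable
  qed
  interpret product_sigma_finite "\<lambda>_. lborel" by standard
  \<comment> \<open>Slice at height \<open>y\<close>. The bound \<open>y \<le> t\<close> can be
    split off because the other coordinates have nonnegative sum.\<close>
  have step: "f (insert b A) t (x(b := y)) = indicator {0..t} y * y ^ a b * f A (t - y) x" for x y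
  proof -
    have sum: "sum (x(b := y)) (insert b A) = y + sum x A"
      using insert.hyps by (auto intro!: sum.cong)
    have prod: "(\<Prod>i\<in>insert b A. (x(b := y)) i ^ a i) = y ^ a b * (\<Prod>i\<in>A. x i ^ a i)"
      using insert.hyps by (simp, intro disjI2 prod.cong) auto
    have "(\<forall>i\<in>insert b A. 0 \<le> (x(b := y)) i) \<longleftrightarrow> 0 \<le> y \<and> (\<forall>i\<in>A. 0 \<le> x i)"
      using insert.hyps by auto
    then have "x(b := y) \<in> S (insert b A) t \<longleftrightarrow> y \<in> {0..t} \<and> x \<in> S A (t - y)"
      unfolding S_def mem_Collect_eq sum using sum_nonneg[of A x] by auto
    then show ?thesis
      unfolding f_def sum prod by (simp add: indicator_def diff_diff_eq)
  qed
  have "(\<integral>\<^sup>+ x. ennreal (f (insert b A) t x) \<partial>?M (insert b A)) =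
        (\<integral>\<^sup>+ y. \<integral>\<^sup>+ x. ennreal (f (insert b A) t (x(b := y))) \<partial>?M A \<partial>lborel)"
    using insert.hyps by (intro product_nn_integral_insert_rev) auto
  also have "\<dots> = (\<integral>\<^sup>+ y. ennreal C * ennreal (indicator {0..t} y * (y ^ a b * (t - y) ^ m)) \<partial>lborel)"
  proof (intro nn_integral_cong)
    fix y :: real
    show "(\<integral>\<^sup>+ x. ennreal (f (insert b A) t (x(b := y))) \<partial>?M A) =
          ennreal C * ennreal (indicator {0..t} y * (y ^ a b * (t - y) ^ m))"
    \<comment> \<open>The induction hypothesis needs \<open>t - y \<ge> 0\<close>; for
      \<open>y\<close> outside \<open>{0..t}\<close> both sides vanish.\<close>
    proof (cases "y \<in> {0..t}")
      case True
      have "(\<integral>\<^sup>+ x. ennreal (f (insert b A) t (x(b := y))) \<partial>?M A) =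
            (\<integral>\<^sup>+ x. ennreal (y ^ a b) * ennreal (f A (t - y) x) \<partial>?M A)"
        using True by (simp add: step ennreal_mult')
      also have "\<dots> = ennreal (y ^ a b) * (\<integral>\<^sup>+ x. ennreal (f A (t - y) x) \<partial>?M A)"
        using insert.hyps by (intro nn_integral_cmult) auto
      also have "(\<integral>\<^sup>+ x. ennreal (f A (t - y) x) \<partial>?M A) = ennreal (C * (t - y) ^ m)"
        using insert.IH[of "t - y"] True by (simp add: f_def S_def C_def m_def)
      finally show ?thesis
        using True C_nonneg by (simp add: mult_ac fun_upd_def flip: ennreal_mult')
    qed (simp add: step)
  qed
  also have "\<dots> = ennreal C *
      (\<integral>\<^sup>+ y. ennreal (indicator {0..t} y * (y ^ a b * (t - y) ^ m)) \<partial>lborel)"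
    by (intro nn_integral_cmult) auto
  also have "(\<integral>\<^sup>+ y. ennreal (indicator {0..t} y * (y ^ a b * (t - y) ^ m)) \<partial>lborel) =
             ennreal (fact (a b) * fact m / fact (a b + m + 1) * t ^ (a b + m + 1))"
  proof (rule nn_integral_has_integral_lborel)
    show "((\<lambda>y. indicator {0..t} y * (y ^ a b * (t - y) ^ m)) has_integral
            fact (a b) * fact m / fact (a b + m + 1) * t ^ (a b + m + 1)) UNIV"
      using has_integral_power_mult_power[OF insert.prems, of "a b" m]
      unfolding has_integral_restrict_UNIV[of "{0..t}", symmetric]
      by (rule has_integral_eq[rotated]) auto
  qed (auto simp: indicator_def)
  also have "ennreal C * \<dots> = ennreal (C * (fact (a b) * fact m / fact (a b + m + 1) * t ^ (a b + m + 1)))"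
    by (rule ennreal_mult'[OF C_nonneg, symmetric])
  also have "C * (fact (a b) * fact m / fact (a b + m + 1) * t ^ (a b + m + 1)) =
      (\<Prod>i\<in>insert b A. fact (a i)) * fact k / fact (card (insert b A) + sum a (insert b A) + k) *
        t ^ (card (insert b A) + sum a (insert b A) + k)"
  proof -
    \<comment> \<open>With the exponents in this form, the \<open>fact m\<close> of the Beta
      integral cancels the denominator of \<open>C\<close>.\<close>
    have eq: "card (insert b A) + sum a (insert b A) + k = a b + m + 1"
      using insert.hyps by (simp add: m_def)
    show ?thesis
      unfolding eq using insert.hyps by (simp add: C_def flip: m_def)
  qed
  finally show ?case by (simp add: f_def S_def)
qed

text \<open>\<open>lborel\<close> is the image of the product measure over \<open>Basis\<close>
  under the map from coordinates to vectors, so the size \<open>t = 1\<close> carries over.\<close>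

lemma nn_integral_simplex_monomial:
  fixes a :: "'a::euclidean_space \<Rightarrow> nat"
  shows "(\<integral>\<^sup>+ x. ennreal (indicator {x. (\<forall>i\<in>Basis. 0 \<le> x \<bullet> i) \<and> (\<Sum>i\<in>Basis. x \<bullet> i) \<le> 1} x *
             ((\<Prod>i\<in>Basis. (x \<bullet> i) ^ a i) * (1 - (\<Sum>i\<in>Basis. x \<bullet> i)) ^ k)) \<partial>lborel) =
         ennreal ((\<Prod>i\<in>Basis. fact (a i)) * fact k / fact (DIM('a) + (\<Sum>i\<in>Basis. a i) + k))"
    (is "(\<integral>\<^sup>+ x. ennreal (?f x) \<partial>lborel) = _")
proof -
  have [measurable]: "Measurable.pred borel
      (\<lambda>x::'a. (\<forall>i\<in>Basis. 0 \<le> x \<bullet> i) \<and> (\<Sum>i\<in>Basis. x \<bullet> i) \<le> 1)"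
    by measurable
  have "(\<integral>\<^sup>+ x. ennreal (?f x) \<partial>lborel) =
        (\<integral>\<^sup>+ y. ennreal (?f (\<Sum>b\<in>Basis. y b *\<^sub>R b)) \<partial>Pi\<^sub>M Basis (\<lambda>_. lborel))"
    by (subst lborel_eq, subst nn_integral_distr) auto
  also have "\<dots> = (\<integral>\<^sup>+ y. ennreal (indicator {x. (\<forall>i\<in>Basis. 0 \<le> x i) \<and> sum x Basis \<le> 1} y *
             ((\<Prod>i\<in>Basis. y i ^ a i) * (1 - sum y Basis) ^ k)) \<partial>Pi\<^sub>M (Basis :: 'a set) (\<lambda>_. lborel))"
    by (intro nn_integral_cong) (simp add: indicator_def)
  also have "\<dots> = ennreal ((\<Prod>i\<in>Basis. fact (a i)) * fact k / fact (DIM('a) + (\<Sum>i\<in>Basis. a i) + k))"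
    by (subst nn_integral_simplex_monomial_PiM) simp_all
  finally show ?thesis .
qed

section \<open>The polynomials \<open>g_poly\<close> and their moments under the uniform
  distribution\<close>

lemma sum_UNIV_option: "(\<Sum>j\<in>UNIV. f j) = f None + (\<Sum>i\<in>UNIV. f (Some i))"
  for f :: "'a::finite option \<Rightarrow> 'b::comm_monoid_add"
  by (simp add: UNIV_option_conv sum.reindex)

lemma prod_UNIV_option: "(\<Prod>j\<in>UNIV. f j) = f None * (\<Prod>i\<in>UNIV. f (Some i))"
  for f :: "'a::finite option \<Rightarrow> 'b::comm_monoid_mult"
  by (simp add: UNIV_option_conv prod.reindex)

lemma sum_g_poly: "(\<Sum>j\<in>UNIV. g_poly j x) = 1"
  by (simp add: sum_UNIV_option)

lemma g_poly_nonneg: "x \<in> simplex_set \<Longrightarrow> 0 \<le> g_poly j x"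
  by (cases j) (auto simp: simplex_set_def)

lemma gpow_nonneg: "x \<in> simplex_set \<Longrightarrow> 0 \<le> gpow \<alpha> x"
  by (simp add: gpow_def prod_nonneg g_poly_nonneg)

lemma real_polynomial_function_gpow: "real_polynomial_function (gpow \<alpha>)"
proof -
  have "real_polynomial_function (g_poly j)" for j :: "'d::finite option"
  proof (cases j)
    case None
    have "real_polynomial_function (\<lambda>x::real^'d. 1 - (\<Sum>j\<in>UNIV. x $ j))"
      by (intro real_polynomial_function_diff real_polynomial_function_sum
            real_polynomial_function.intros bounded_linear_vec_nth) auto
    moreover have "g_poly None = (\<lambda>x::real^'d. 1 - (\<Sum>j\<in>UNIV. x $ j))" by auto
    ultimately show ?thesis using None by simp
  next
    case (Some i)
    have "g_poly (Some i) = (\<lambda>x::real^'d. x $ i)" by auto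
    then show ?thesis using Some
      by (simp add: real_polynomial_function.intros bounded_linear_vec_nth)
  qed
  then show ?thesis
    unfolding gpow_def by (intro real_polynomial_function_prod real_polynomial_function_power) auto
qed

lemma borel_measurable_gpow [measurable]: "gpow \<alpha> \<in> borel_measurable borel"
  using continuous_on_polymonial_function[of "gpow \<alpha>" UNIV] real_polynomial_function_gpow[of \<alpha>]
  by (simp add: borel_measurable_continuous_onI real_polynomial_function_eq)

lemma sets_simplex_set [measurable]: "simplex_set \<in> sets borel"
  unfolding simplex_set_def by measurable

lemma nn_integral_simplex_gpow:
  fixes \<alpha> :: "'d::finite option \<Rightarrow> nat"
  shows "(\<integral>\<^sup>+ x. ennreal (indicator simplex_set x * gpow \<alpha> x) \<partial>lborel) =
         ennreal ((\<Prod>j\<in>UNIV. fact (\<alpha> j)) / fact (CARD('d) + (\<Sum>j\<in>UNIV. \<alpha> j)))"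
proof -
  \<comment> \<open>The basis vectors are \<open>axis i 1\<close>, and \<open>axis_index\<close>
    recovers \<open>i\<close>. The exponent at \<open>None\<close> becomes \<open>k\<close>, that of
    the slack.\<close>
  define a :: "real ^ 'd \<Rightarrow> nat" where "a = (\<lambda>b. \<alpha> (Some (axis_index b)))"
  have Basis: "(Basis :: (real ^ 'd) set) = range (\<lambda>i. axis i 1)"
    by (auto simp: Basis_vec_def)
  have inj: "inj (\<lambda>i::'d. axis i (1::real))"
    by (auto simp: inj_on_def axis_eq_axis)
  have a: "a (axis i 1) = \<alpha> (Some i)" for i
    by (simp add: a_def)
  show ?thesis
    using nn_integral_simplex_monomial[of a "\<alpha> None"]
    by (simp add: Basis sum.reindex prod.reindex card_image inj a inner_axis simplex_set_def gpow_def
          sum_UNIV_option prod_UNIV_option mult_ac add_ac)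
qed

text \<open>The volume is the moment of the zero exponent, for which \<open>gpow\<close> is
  constantly 1.\<close>

lemma emeasure_simplex_set:
  "emeasure lborel (simplex_set :: (real ^ 'd::finite) set) = ennreal (1 / fact CARD('d))"
proof -
  have "emeasure lborel (simplex_set :: (real ^ 'd) set) =
        (\<integral>\<^sup>+ x. ennreal (indicator (simplex_set :: (real ^ 'd) set) x * gpow (\<lambda>_. 0) x) \<partial>lborel)"
    by (simp add: gpow_def ennreal_indicator)
  then show ?thesis by (simp add: nn_integral_simplex_gpow)
qed

text \<open>Dividing by the volume produces the factor \<open>fact CARD('d)\<close>. Integrability
  is recorded together with the value so that the feasibility constraint can be integrated term by
  term.\<close>

lemma has_bochner_integral_unif_simplex_gpow:
  fixes \<alpha> :: "'d::finite option \<Rightarrow> nat"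
  shows "has_bochner_integral unif_simplex (\<lambda>x. indicator simplex_set x * gpow \<alpha> x)
           (fact CARD('d) * (\<Prod>j\<in>UNIV. fact (\<alpha> j)) / fact (CARD('d) + (\<Sum>j\<in>UNIV. \<alpha> j)))"
proof (rule has_bochner_integral_nn_integral)
  have [measurable]: "(\<lambda>x. indicator simplex_set x * gpow \<alpha> x) \<in> borel_measurable borel"
    by measurable
  then show "(\<lambda>x. indicator simplex_set x * gpow \<alpha> x) \<in> borel_measurable unif_simplex"
    by (simp add: unif_simplex_def)
  show "AE x in unif_simplex. 0 \<le> indicator simplex_set x * gpow \<alpha> x"
    by (simp add: gpow_nonneg indicator_def)
  show "0 \<le> fact CARD('d) * (\<Prod>j\<in>UNIV. fact (\<alpha> j) :: real) / fact (CARD('d) + (\<Sum>j\<in>UNIV. \<alpha> j))"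
    by (simp add: prod_nonneg)
  have "(\<integral>\<^sup>+ x. ennreal (indicator simplex_set x * gpow \<alpha> x) \<partial>unif_simplex) =
        (\<integral>\<^sup>+ x. ennreal (indicator simplex_set x * gpow \<alpha> x) * indicator simplex_set x \<partial>lborel) /
        emeasure lborel (simplex_set :: (real ^ 'd) set)"
    unfolding unif_simplex_def by (rule nn_integral_uniform_measure) simp_all
  \<comment> \<open>The uniform measure contributes a second copy of the indicator, which is
    absorbed.\<close>
  also have "(\<integral>\<^sup>+ x. ennreal (indicator simplex_set x * gpow \<alpha> x) * indicator simplex_set x \<partial>lborel) =
        (\<integral>\<^sup>+ x. ennreal (indicator simplex_set x * gpow \<alpha> x) \<partial>lborel)"
    by (intro nn_integral_cong) (simp add: indicator_def)
  finally show "(\<integral>\<^sup>+ x. ennreal (indicator simplex_set x * gpow \<alpha> x) \<partial>unif_simplex) =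
      ennreal (fact CARD('d) * (\<Prod>j\<in>UNIV. fact (\<alpha> j)) / fact (CARD('d) + (\<Sum>j\<in>UNIV. \<alpha> j)))"
    by (simp add: nn_integral_simplex_gpow emeasure_simplex_set divide_ennreal prod_nonneg)
qed

lemma phi_star_gpow:
  fixes \<alpha> :: "'d::finite option \<Rightarrow> nat"
  shows "phi_star (gpow \<alpha>) =
    fact CARD('d) * (\<Prod>j\<in>UNIV. fact (\<alpha> j)) / fact (CARD('d) + (\<Sum>j\<in>UNIV. \<alpha> j))"
  using has_bochner_integral_integral_eq[OF has_bochner_integral_unif_simplex_gpow[of \<alpha>]]
  by (simp add: phi_star_def set_lebesgue_integral_def)

lemma phi_star_gpow_pos: "phi_star (gpow \<alpha>) > 0"
  by (simp add: phi_star_gpow prod_pos)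

section \<open>The multinomial theorem and the constant sum\<close>

lemma prod_fps_exp: "(\<Prod>j\<in>A. fps_exp (x j)) = fps_exp (\<Sum>j\<in>A. x j)"
  for x :: "'i \<Rightarrow> 'a::field_char_0"
  by (induction A rule: infinite_finite_induct) (simp_all add: fps_exp_add_mult)

text \<open>Compare coefficients of order \<open>k\<close> in a product of exponential series:
  expanded it is a sum over multisets of size \<open>k\<close>, whose \<open>count\<close> functions
  are the exponent vectors; collapsed it is one exponential.\<close>

lemma multinomial_theorem:
  fixes x :: "'i::finite \<Rightarrow> 'a::field_char_0"
  shows "(\<Sum>\<alpha> | (\<Sum>j\<in>UNIV. \<alpha> j) = k. \<Prod>j\<in>UNIV. x j ^ \<alpha> j / fact (\<alpha> j)) =
         (\<Sum>j\<in>UNIV. x j) ^ k / fact k"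
proof -
  have size: "size M = (\<Sum>j\<in>UNIV. count M j)" for M :: "'i multiset"
    unfolding size_multiset_overloaded_eq
    by (intro sum.mono_neutral_cong_left) (auto simp: not_in_iff)
  have "bij_betw count (multisets_of_size (UNIV :: 'i set) k) {\<alpha>. (\<Sum>j\<in>UNIV. \<alpha> j) = k}"
    by (rule bij_betwI[where g = Abs_multiset])
       (auto simp: multisets_of_size_def size Abs_multiset_inverse count_inverse)
  then have "(\<Sum>\<alpha> | (\<Sum>j\<in>UNIV. \<alpha> j) = k. \<Prod>j\<in>UNIV. x j ^ \<alpha> j / fact (\<alpha> j)) =
        (\<Sum>X\<in>multisets_of_size UNIV k. \<Prod>j\<in>UNIV. x j ^ count X j / fact (count X j))"
    by (rule sum.reindex_bij_betw[symmetric])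
  also have "\<dots> = fps_nth (\<Prod>j\<in>UNIV. fps_exp (x j)) k"
    by (simp add: fps_prod_nth')
  finally show ?thesis by (simp add: prod_fps_exp)
qed

lemma multi_indices_eq_UN: "multi_indices n = (\<Union>k\<le>n. {\<alpha>. (\<Sum>j\<in>UNIV. \<alpha> j) = k})"
  by (auto simp: multi_indices_def)

lemma finite_multi_indices: "finite (multi_indices n)"
  by (simp add: multi_indices_eq_UN finite_multi_indices_eq)

lemma sum_gpow_div_phi_star:
  fixes x :: "real ^ 'd::finite"
  shows "(\<Sum>\<alpha>\<in>multi_indices n. gpow \<alpha> x / phi_star (gpow \<alpha>)) = s_hat CARD('d) n"
proof -
  \<comment> \<open>On a fixed level the denominator of the moment depends only on \<open>k\<close>,
    so it leaves the sum, and the multinomial theorem applies with base 1.\<close>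
  have level: "(\<Sum>\<alpha> | (\<Sum>j\<in>UNIV. \<alpha> j) = k. gpow \<alpha> x / phi_star (gpow \<alpha>)) = (CARD('d) + k) choose k"
    for k
  proof -
    have "(\<Sum>\<alpha> | (\<Sum>j\<in>UNIV. \<alpha> j) = k. gpow \<alpha> x / phi_star (gpow \<alpha>)) =
          (\<Sum>\<alpha> | (\<Sum>j\<in>UNIV. \<alpha> j) = k. fact (CARD('d) + k) / fact CARD('d) *
             (\<Prod>j\<in>UNIV. g_poly j x ^ \<alpha> j / fact (\<alpha> j)))"
      by (intro sum.cong) (auto simp: phi_star_gpow gpow_def prod_dividef)
    also have "\<dots> = fact (CARD('d) + k) / fact CARD('d) * (1 / fact k)"
      unfolding sum_distrib_left[symmetric] multinomial_theorem sum_g_poly by simp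
    also have "\<dots> = (CARD('d) + k) choose k"
      by (simp add: binomial_fact)
    finally show ?thesis .
  qed
  have "(\<Sum>\<alpha>\<in>multi_indices n. gpow \<alpha> x / phi_star (gpow \<alpha>)) =
      (\<Sum>k\<le>n. \<Sum>\<alpha> | (\<Sum>j\<in>UNIV. \<alpha> j) = k. gpow \<alpha> x / phi_star (gpow \<alpha>))"
    by (simp add: multi_indices_eq_UN sum.UNION_disjoint finite_multi_indices_eq disjoint_iff)
  also have "\<dots> = real (\<Sum>k\<le>n. (CARD('d) + k) choose k)"
    by (simp add: level)
  \<comment> \<open>The levels add up by the hockey-stick identity.\<close>
  finally show ?thesis by (simp add: sum_choose_lower s_hat_def)
qed

section \<open>The entropy bound for feasible vectors\<close>

text \<open>Reduces the functional constraint to one linear equation in \<open>c\<close>, the form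
  in which it enters the entropy bound.\<close>

lemma feasible_sum_phi_star:
  fixes c :: "('d::finite option \<Rightarrow> nat) \<Rightarrow> real"
  assumes "feasible n c"
  shows "(\<Sum>\<alpha>\<in>multi_indices n. c \<alpha> * phi_star (gpow \<alpha>)) = s_hat CARD('d) n"
proof -
  let ?i = "\<lambda>x::real^'d. indicator simplex_set x :: real"
  have moment: "has_bochner_integral unif_simplex (\<lambda>x. ?i x * gpow \<alpha> x) (phi_star (gpow \<alpha>))" for \<alpha>
    unfolding phi_star_gpow by (rule has_bochner_integral_unif_simplex_gpow)
  have one: "gpow (\<lambda>_. 0) x = 1" for x :: "real ^ 'd" by (simp add: gpow_def)
  have "has_bochner_integral unif_simplex ?i 1"
    using moment[of "\<lambda>_. 0"] by (simp add: one phi_star_gpow)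
  then have "has_bochner_integral unif_simplex (\<lambda>x. s_hat CARD('d) n * ?i x) (real (s_hat CARD('d) n) * 1)"
    by (intro has_bochner_integral_mult_right)
  moreover have "has_bochner_integral unif_simplex (\<lambda>x. \<Sum>\<alpha>\<in>multi_indices n. c \<alpha> * (?i x * gpow \<alpha> x))
      (\<Sum>\<alpha>\<in>multi_indices n. c \<alpha> * phi_star (gpow \<alpha>))"
    by (intro has_bochner_integral_sum has_bochner_integral_mult_right moment)
  \<comment> \<open>Feasibility makes the two integrands equal pointwise, so uniqueness of the
    integral equates the two values.\<close>
  moreover have "(\<Sum>\<alpha>\<in>multi_indices n. c \<alpha> * (?i x * gpow \<alpha> x)) = s_hat CARD('d) n * ?i x" for x
    using assms by (simp add: feasible_def mult.left_commute[of _ "?i x"] mult.commute[of _ "?i x"]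
          flip: sum_distrib_left)
  ultimately show ?thesis
    by (auto dest: has_bochner_integral_eq)
qed

text \<open>By concavity \<open>ln\<close> lies below its tangent at \<open>1 / w\<close>, whose
  slope is \<open>w\<close>; at \<open>c = 0\<close> the left side is minus infinity.\<close>

lemma elog_le_tangent:
  assumes "c \<ge> 0" "w > 0"
  shows "elog c \<le> ereal (ln (1 / w) + (c * w - 1))"
proof (cases "c = 0")
  case False
  with assms have "ln (c * w) \<le> c * w - 1" by (intro ln_le_minus_one) auto
  with False assms show ?thesis by (simp add: elog_def ln_mult ln_div)
qed (simp add: elog_def)

text \<open>The tangent touches \<open>ln\<close> only at \<open>1 / w\<close>.\<close>

lemma elog_less_tangent:
  assumes "c \<ge> 0" "w > 0" "c \<noteq> 1 / w"
  shows "elog c < ereal (ln (1 / w) + (c * w - 1))"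
proof (cases "c = 0")
  case False
  have "c * w \<noteq> 1" using assms by (simp add: field_simps)
  with False assms have "ln (c * w) \<noteq> c * w - 1"
    using ln_eq_minus_one[of "c * w"] by auto
  moreover have "ln (c * w) \<le> c * w - 1" using False assms by (intro ln_le_minus_one) auto
  ultimately show ?thesis using False assms by (simp add: elog_def ln_mult ln_div)
qed (simp add: elog_def)

text \<open>A form of Gibbs' inequality: summing the tangent bounds, the linear terms cancel by the
  normalisation of \<open>c\<close>, and the index \<open>k\<close> makes the result strict.\<close>

lemma sum_elog_less:
  fixes c w :: "'i \<Rightarrow> real"
  assumes "finite A" and c: "\<And>i. i \<in> A \<Longrightarrow> c i \<ge> 0" and w: "\<And>i. i \<in> A \<Longrightarrow> w i > 0"
    and sum: "(\<Sum>i\<in>A. c i * w i) = card A" and "k \<in> A" "c k \<noteq> 1 / w k"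
  shows "(\<Sum>i\<in>A. elog (c i)) < (\<Sum>i\<in>A. elog (1 / w i))"
proof -
  define r where "r i = ln (1 / w i) + (c i * w i - 1)" for i
  have "(\<Sum>i\<in>A. elog (c i)) = elog (c k) + (\<Sum>i\<in>A - {k}. elog (c i))"
    using assms by (simp add: sum.remove)
  \<comment> \<open>The other terms are bounded first: their sum is then finite, and adding it
    preserves the strict inequality at \<open>k\<close>, which adding minus infinity would
    not.\<close>
  also have "\<dots> \<le> elog (c k) + (\<Sum>i\<in>A - {k}. ereal (r i))"
    using c w unfolding r_def by (intro add_left_mono sum_mono elog_le_tangent) auto
  also have "\<dots> < ereal (r k) + (\<Sum>i\<in>A - {k}. ereal (r i))"
    using elog_less_tangent[of "c k" "w k"] assms by (cases "elog (c k)") (auto simp: r_def)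
  also have "\<dots> = ereal (\<Sum>i\<in>A. r i)"
    using assms by (simp add: sum.remove)
  also have "(\<Sum>i\<in>A. r i) = (\<Sum>i\<in>A. ln (1 / w i))"
    using sum by (simp add: r_def sum.distrib sum_subtractf)
  also have "ereal \<dots> = (\<Sum>i\<in>A. elog (1 / w i))"
    using w by (subst sum_ereal[symmetric], intro sum.cong) (auto simp: elog_def dest: w)
  finally show ?thesis .
qed

section \<open>Optimality, uniqueness and the partition of unity\<close>

theorem theorem4p1:
  fixes n :: nat
  assumes "n \<in> {1, 2}"
  shows "\<exists>c :: ('d::finite option \<Rightarrow> nat) \<Rightarrow> real.
      (\<forall>c'. optimal_solution n c' \<longleftrightarrow> c' = c) \<and>
      (\<forall>\<alpha>\<in>multi_indices n. c \<alpha> > 0) \<and>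
      (\<forall>\<alpha>\<in>multi_indices n. 1 / c \<alpha> = phi_star (gpow \<alpha>)) \<and>
      (\<forall>x :: real ^ 'd.
        1 = 1 / real (s_hat CARD('d) n) *
          (\<Sum>\<alpha>\<in>multi_indices n. gpow \<alpha> x / phi_star (gpow \<alpha>))) \<and>
      polynomial_partition_of_unity (simplex_set :: (real ^ 'd) set)
        (multi_indices n :: ('d option \<Rightarrow> nat) set)
        (\<lambda>\<alpha> x. 1 / real (s_hat CARD('d) n) * (gpow \<alpha> x / phi_star (gpow \<alpha>))) \<and>
      optimal_solution n
        (\<lambda>\<alpha>\<in>(multi_indices n :: ('d option \<Rightarrow> nat) set). 1 / phi_star (gpow \<alpha>))"
proof -
  let ?I = "multi_indices n :: ('d option \<Rightarrow> nat) set"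
  \<comment> \<open>Restricted to the index set, since \<open>feasible\<close> asks for extensional
    functions.\<close>
  define c where "c = (\<lambda>\<alpha>\<in>?I. 1 / phi_star (gpow \<alpha>))"
  have c_eq: "c \<alpha> = 1 / phi_star (gpow \<alpha>)" if "\<alpha> \<in> ?I" for \<alpha>
    using that by (simp add: c_def)
  have s_hat_pos: "s_hat CARD('d) n > 0" by (simp add: s_hat_def)
  have feasible: "feasible n c"
  proof -
    have "(\<Sum>\<alpha>\<in>?I. c \<alpha> * gpow \<alpha> x) = s_hat CARD('d) n" for x
      by (subst sum_gpow_div_phi_star[symmetric, of _ x]) (simp add: c_eq)
    moreover have "c \<in> ?I \<rightarrow>\<^sub>E {0..}"
      by (auto simp: c_def phi_star_gpow_pos less_imp_le)
    ultimately show ?thesis by (simp add: feasible_def)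
  qed
  have less: "entropy n c' < entropy n c" if c': "feasible n c'" "c' \<noteq> c" for c'
  proof -
    \<comment> \<open>Distinct extensional functions differ at some index inside the set.\<close>
    obtain k where k: "k \<in> ?I" "c' k \<noteq> c k"
      using PiE_ext[of c' ?I "\<lambda>_. {0..}" c] c' feasible by (auto simp: feasible_def)
    have "(\<Sum>\<alpha>\<in>?I. elog (c' \<alpha>)) < (\<Sum>\<alpha>\<in>?I. elog (1 / phi_star (gpow \<alpha>)))"
    proof (rule sum_elog_less)
      show "c' \<alpha> \<ge> 0" if "\<alpha> \<in> ?I" for \<alpha>
        using c' that by (auto simp: feasible_def)
      \<comment> \<open>The constant \<open>s_hat\<close> of the constraint is exactly the number of
        indices, as the entropy bound requires.\<close>
      show "(\<Sum>\<alpha>\<in>?I. c' \<alpha> * phi_star (gpow \<alpha>)) = card ?I"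
        using c' by (simp add: feasible_sum_phi_star card_multi_indices)
      show "c' k \<noteq> 1 / phi_star (gpow k)" using k by (simp add: c_eq)
    qed (use k in \<open>simp_all add: finite_multi_indices phi_star_gpow_pos\<close>)
    then show ?thesis by (simp add: entropy_def c_eq)
  qed
  \<comment> \<open>\<open>is_arg_max\<close> only excludes strictly better feasible vectors. By
    \<open>less\<close> nothing beats \<open>c\<close>, while \<open>c\<close> beats every other
    feasible vector.\<close>
  have optimal: "optimal_solution n c' \<longleftrightarrow> c' = c" for c'
    using feasible less unfolding optimal_solution_def is_arg_max_def
    by (metis less_asym less_irrefl)
  have identity: "1 = 1 / real (s_hat CARD('d) n) *
      (\<Sum>\<alpha>\<in>?I. gpow \<alpha> x / phi_star (gpow \<alpha>))" for x
    using s_hat_pos by (simp add: sum_gpow_div_phi_star)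
  have "polynomial_partition_of_unity simplex_set ?I
      (\<lambda>\<alpha> x. 1 / real (s_hat CARD('d) n) * (gpow \<alpha> x / phi_star (gpow \<alpha>)))"
    unfolding polynomial_partition_of_unity_def
  proof (intro conjI ballI allI)
    show "real_polynomial_function
        (\<lambda>x. 1 / real (s_hat CARD('d) n) * (gpow \<alpha> x / phi_star (gpow \<alpha>)))" for \<alpha> :: "'d option \<Rightarrow> nat"
      unfolding divide_inverse
      by (intro real_polynomial_function.intros real_polynomial_function_gpow)
    show "0 \<le> 1 / real (s_hat CARD('d) n) * (gpow \<alpha> x / phi_star (gpow \<alpha>))"
      if "x \<in> simplex_set" for \<alpha> and x :: "real ^ 'd"
      using that by (simp add: gpow_nonneg phi_star_gpow_pos less_imp_le)
    show "(\<Sum>\<alpha>\<in>?I. 1 / real (s_hat CARD('d) n) * (gpow \<alpha> x / phi_star (gpow \<alpha>))) = 1" for x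
      using identity[of x] by (simp only: sum_distrib_left)
  qed (rule finite_multi_indices)
  moreover have "\<forall>\<alpha>\<in>?I. c \<alpha> > 0" "\<forall>\<alpha>\<in>?I. 1 / c \<alpha> = phi_star (gpow \<alpha>)"
    by (simp_all add: c_eq phi_star_gpow_pos)
  ultimately show ?thesis
    using optimal identity by (intro exI[of _ c]) (simp flip: c_def)
qed

end
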